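(* Let $X,Y$ be realcompact spaces and let $E$ and $F$ be nontrivial Hausdorff topological vector spaces. If there is a (not necessarily linear) biseparating map $T:C(X,E)\to C(Y,F)$, then $X$ and $Y$ are homeomorphic.
   Context: $C(X,E)$ is the space of continuous functions $X\to E$. A Hausdorff completely regular space $X$ with Stone–Čech compactification $\beta X$ is realcompact if for any $x_0\in\beta X\setminus X$ there is a continuous function $f:\beta X\to[0,1]$ with $f(x_0)=1>f(x)$ for all $x\in X$. For a function $f$ let $C(f)=\{x: f(x)\neq 0\}$, and for functions $f,g,h$ in the same space write $f\perp_h g$ if $C(f-h)\cap C(g-h)=\emptyset$. A map $T$ between two function spaces is biseparating if it is a bijection and for all $f,g,h$ in its domain: $f\perp_h g\iff Tf\perp_{Th}Tg$. *)

theory Defs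
  imports "HOL-Analysis.Analysis"
begin

text \<open>
  Topological vector spaces over the reals.  A complex topological vector space is in particular a
  real one with the same topology, and no notion below mentions the scalars.  Continuity of negation
  (part of \<^class>\<open>topological_ab_group_add\<close>) already follows from that of scalar multiplication,
  so it is not an extra requirement.  The Hausdorff property is the separate class
  \<^class>\<open>t2_space\<close>.
\<close>

class topological_real_vector = topological_ab_group_add + real_vector +
  assumes tendsto_scaleR_Pair:
    "LIM x (nhds c \<times>\<^sub>F nhds a). fst x *\<^sub>R snd x :> nhds (c *\<^sub>R a)"

instance real_normed_vector < topological_real_vector
proof
  fix c :: real and a :: 'a
  show "LIM x (nhds c \<times>\<^sub>F nhds a). fst x *\<^sub>R snd x :> nhds (c *\<^sub>R a)"
    by (intro tendsto_scaleR filterlim_fst filterlim_snd)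
qed

text \<open>
  A space is an \<^typ>\<open>'a topology\<close>.  A continuous function on it is represented by its unique
  extension to the type that is \<^const>\<open>undefined\<close> off the carrier, so that equality of elements of
  \<open>cont_maps X Z\<close> is equality of functions on \<open>topspace X\<close>.
\<close>

definition cont_maps :: "'a topology \<Rightarrow> 'b topology \<Rightarrow> ('a \<Rightarrow> 'b) set" where
  "cont_maps X Z = {f \<in> extensional (topspace X). continuous_map X Z f}"

abbreviation cont_funs :: "'a topology \<Rightarrow> ('a \<Rightarrow> 'e::topological_space) set" where
  "cont_funs X \<equiv> cont_maps X euclidean"


subsection \<open>Stone-Cech compactification and realcompact spaces\<close>

abbreviation unit_interval :: "real topology" where
  "unit_interval \<equiv> top_of_set {0..1}"

text \<open>
  The standard construction: the closure of the image of \<open>X\<close> under the evaluation map into the cube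
  with one factor \<open>[0,1]\<close> for each continuous function from \<open>X\<close> to \<open>[0,1]\<close>.
\<close>

definition stone_cech_cube :: "'a topology \<Rightarrow> (('a \<Rightarrow> real) \<Rightarrow> real) topology" where
  "stone_cech_cube X = product_topology (\<lambda>_. unit_interval) (cont_maps X unit_interval)"

definition stone_cech_map :: "'a topology \<Rightarrow> 'a \<Rightarrow> ('a \<Rightarrow> real) \<Rightarrow> real" where
  "stone_cech_map X x = (\<lambda>f \<in> cont_maps X unit_interval. f x)"

definition stone_cech :: "'a topology \<Rightarrow> (('a \<Rightarrow> real) \<Rightarrow> real) topology" where
  "stone_cech X =
     subtopology (stone_cech_cube X) (stone_cech_cube X closure_of (stone_cech_map X ` topspace X))"

text \<open>Points of \<open>X\<close> are identified with their images in \<open>stone_cech X\<close>.\<close>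

definition realcompact_space :: "'a topology \<Rightarrow> bool" where
  "realcompact_space X \<longleftrightarrow>
     Hausdorff_space X \<and> completely_regular_space X \<and>
     (\<forall>p \<in> topspace (stone_cech X) - stone_cech_map X ` topspace X.
        \<exists>u. continuous_map (stone_cech X) unit_interval u \<and> u p = 1 \<and>
            (\<forall>x \<in> topspace X. u (stone_cech_map X x) < 1))"

text \<open>
  The properties characterising the Stone-Cech compactification of a Hausdorff completely regular
  space: it is compact Hausdorff, contains \<open>X\<close> as a dense subspace, and every continuous function
  from \<open>X\<close> to \<open>[0,1]\<close> extends to it.
\<close>

lemma continuous_map_stone_cech_cube:
  "continuous_map X (stone_cech_cube X) (stone_cech_map X)"
  unfolding stone_cech_cube_def continuous_map_componentwise
  by (auto simp: stone_cech_map_def cont_maps_def)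

lemma stone_cech_map_in_cube:
  "stone_cech_map X ` topspace X \<subseteq> topspace (stone_cech_cube X)"
  using continuous_map_stone_cech_cube by (metis continuous_map_image_subset_topspace)

lemma compact_space_stone_cech: "compact_space (stone_cech X)"
proof -
  have "compact_space (stone_cech_cube X)"
    by (simp add: stone_cech_cube_def compact_space_product_topology compact_space_subtopology)
  then show ?thesis
    unfolding stone_cech_def
    by (intro compact_space_subtopology closedin_compact_space closedin_closure_of)
qed

lemma Hausdorff_space_stone_cech: "Hausdorff_space (stone_cech X)"
  by (simp add: stone_cech_def stone_cech_cube_def Hausdorff_space_subtopology
      Hausdorff_space_product_topology)

lemma continuous_map_stone_cech: "continuous_map X (stone_cech X) (stone_cech_map X)"
  unfolding stone_cech_def
proof (rule continuous_map_into_subtopology[OF continuous_map_stone_cech_cube])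
  show "stone_cech_map X \<in> topspace X \<rightarrow>
      stone_cech_cube X closure_of (stone_cech_map X ` topspace X)"
    using closure_of_subset[OF stone_cech_map_in_cube[of X]] by blast
qed

lemma dense_stone_cech:
  "stone_cech X closure_of (stone_cech_map X ` topspace X) = topspace (stone_cech X)"
proof -
  let ?S = "stone_cech_map X ` topspace X" and ?C = "stone_cech_cube X"
  have sub: "?S \<subseteq> ?C closure_of ?S"
    by (rule closure_of_subset[OF stone_cech_map_in_cube])
  then have "stone_cech X closure_of ?S = ?C closure_of ?S"
    by (simp add: stone_cech_def closure_of_subtopology Int_absorb1)
  moreover have "topspace (stone_cech X) = ?C closure_of ?S"
    by (simp add: stone_cech_def Int_absorb1 closure_of_subset_topspace)
  ultimately show ?thesis by simp
qed

lemma stone_cech_extension: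
  assumes "continuous_map X unit_interval f"
  obtains g where "continuous_map (stone_cech X) unit_interval g"
    and "\<And>x. x \<in> topspace X \<Longrightarrow> g (stone_cech_map X x) = f x"
proof
  define f' where "f' = restrict f (topspace X)"
  have f': "f' \<in> cont_maps X unit_interval"
    using assms unfolding cont_maps_def f'_def
    by (auto intro: continuous_map_eq)
  show "continuous_map (stone_cech X) unit_interval (\<lambda>p. p f')"
    unfolding stone_cech_def stone_cech_cube_def
    by (intro continuous_map_from_subtopology continuous_map_product_projection f')
  show "stone_cech_map X x f' = f x" if "x \<in> topspace X" for x
    using that f' by (simp add: stone_cech_map_def f'_def)
qed

lemma embedding_map_stone_cech:
  assumes "Hausdorff_space X" "completely_regular_space X"
  shows "embedding_map X (stone_cech X) (stone_cech_map X)"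
proof -
  let ?e = "stone_cech_map X" and ?B = "stone_cech X"
  have cont: "continuous_map X ?B ?e" by (rule continuous_map_stone_cech)
  have sep: "\<exists>g. continuous_map ?B unit_interval g \<and> g (?e x) = 0 \<and> (\<forall>y\<in>S. g (?e y) = 1)"
    if "closedin X S" "x \<in> topspace X - S" for S x
  proof -
    obtain f where f: "continuous_map X unit_interval f" "f x = 0" "f ` S \<subseteq> {1}"
      using assms(2) \<open>closedin X S\<close> \<open>x \<in> topspace X - S\<close>
      unfolding completely_regular_space_def by metis
    obtain g where "continuous_map ?B unit_interval g" "\<And>x. x \<in> topspace X \<Longrightarrow> g (?e x) = f x"
      using stone_cech_extension[OF f(1)] by blast
    then show ?thesis
      using f that closedin_subset[OF that(1)] by (intro exI[of _ g]) auto
  qed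
  have inj: "inj_on ?e (topspace X)"
  proof (rule inj_onI, rule ccontr)
    fix x y assume xy: "x \<in> topspace X" "y \<in> topspace X" "?e x = ?e y" "x \<noteq> y"
    have "closedin X {y}"
      using assms(1) xy by (simp add: closedin_Hausdorff_singleton)
    then show False
      using sep[of "{y}" x] xy by auto
  qed
  have "openin (subtopology ?B (?e ` topspace X)) (?e ` U)" if U: "openin X U" for U
  proof (subst openin_subopen, intro ballI)
    fix p assume "p \<in> ?e ` U"
    then obtain x where x: "x \<in> U" "p = ?e x" by blast
    have Utop: "U \<subseteq> topspace X" using U by (rule openin_subset)
    obtain g where g: "continuous_map ?B unit_interval g" "g (?e x) = 0"
        "\<forall>y\<in>topspace X - U. g (?e y) = 1"
      using sep[of "topspace X - U" x] U x Utop by (auto simp: closedin_def Diff_Diff_Int Int_absorb1)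
    define V where "V = {q \<in> topspace ?B. g q \<in> {..<1}}"
    have "continuous_map ?B euclideanreal g"
      using g(1) by (simp add: continuous_map_in_subtopology)
    then have "openin ?B V"
      unfolding V_def by (rule openin_continuous_map_preimage) auto
    then have "openin (subtopology ?B (?e ` topspace X)) (V \<inter> ?e ` topspace X)"
      by (auto simp: openin_subtopology)
    moreover have "p \<in> V \<inter> ?e ` topspace X"
      using x g(2) Utop cont by (auto simp: V_def continuous_map_def)
    moreover have "V \<inter> ?e ` topspace X \<subseteq> ?e ` U"
    proof
      fix q assume "q \<in> V \<inter> ?e ` topspace X"
      then obtain y where y: "y \<in> topspace X" "q = ?e y" "g (?e y) < 1"
        by (auto simp: V_def)
      then have "y \<in> U" using g(3) by force
      then show "q \<in> ?e ` U" using y by blast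
    qed
    ultimately show "\<exists>T. openin (subtopology ?B (?e ` topspace X)) T \<and> p \<in> T \<and> T \<subseteq> ?e ` U"
      by blast
  qed
  then have "open_map X (subtopology ?B (?e ` topspace X)) ?e"
    by (simp add: open_map_def)
  moreover have "continuous_map X (subtopology ?B (?e ` topspace X)) ?e"
    using cont by (simp add: continuous_map_in_subtopology)
  moreover have "?e ` topspace X = topspace (subtopology ?B (?e ` topspace X))"
    using continuous_map_image_subset_topspace[OF cont] by auto
  ultimately show ?thesis
    unfolding embedding_map_def using inj by (metis bijective_open_imp_homeomorphic_map)
qed


subsection \<open>Biseparating maps\<close>

definition cozero :: "'a topology \<Rightarrow> ('a \<Rightarrow> 'e::zero) \<Rightarrow> 'a set" where
  "cozero X f = {x \<in> topspace X. f x \<noteq> 0}"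

text \<open>\<open>disjoint_rel X h f g\<close> is the relation \<open>f \<bottom>\<^sub>h g\<close>.\<close>

definition disjoint_rel ::
    "'a topology \<Rightarrow> ('a \<Rightarrow> 'e::ab_group_add) \<Rightarrow> ('a \<Rightarrow> 'e) \<Rightarrow> ('a \<Rightarrow> 'e) \<Rightarrow> bool" where
  "disjoint_rel X h f g \<longleftrightarrow> cozero X (\<lambda>x. f x - h x) \<inter> cozero X (\<lambda>x. g x - h x) = {}"

definition biseparating ::
    "'a topology \<Rightarrow> 'b topology \<Rightarrow>
     (('a \<Rightarrow> 'e::{topological_space,ab_group_add}) \<Rightarrow>
      ('b \<Rightarrow> 'f::{topological_space,ab_group_add})) \<Rightarrow> bool" where
  "biseparating X Y T \<longleftrightarrow>
     bij_betw T (cont_funs X) (cont_funs Y) \<and>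
     (\<forall>f \<in> cont_funs X. \<forall>g \<in> cont_funs X. \<forall>h \<in> cont_funs X.
        disjoint_rel X h f g \<longleftrightarrow> disjoint_rel Y (T h) (T f) (T g))"

end

theory Submission
  imports Defs
begin

text \<open>
  The theorem recovers points from pairs of open sets.  For open \<open>U \<subseteq> X\<close> and \<open>V \<subseteq> Y\<close> say that
  \<open>U\<close> misses \<open>V\<close> if altering a function inside \<open>U\<close> never changes its image under \<open>T\<close> on \<open>V\<close>.
  Points \<open>x\<close> and \<open>y\<close> correspond if no neighbourhood of \<open>x\<close> misses a neighbourhood of \<open>y\<close>; this
  relation turns out to be the graph of a homeomorphism.

  Three facts about missing carry the argument.  If \<open>f\<close> and \<open>g\<close> agree on \<open>U\<close>, then \<open>U\<close> misses the
  open set where \<open>T f\<close> and \<open>T g\<close> differ: this is disjointness at the base point \<open>g\<close>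
  (\<open>agree_misses_at\<close>).  Missing is symmetric under passing to the inverse of \<open>T\<close>
  (\<open>misses_at_inverse_iff\<close>), which makes it stable under arbitrary unions.  Finally it suffices to
  test missing at a single base point (\<open>misses_at_change_base\<close>); this is what lets one combine
  pieces of functions that have nothing to do with one another.

  Suppose \<open>x\<close> corresponds to \<open>y\<close> and \<open>Q\<close> is a neighbourhood of \<open>x\<close>.  A function that equals
  the preimage of the constant 0 near \<open>x\<close>, and the preimage of a constant \<open>w \<noteq> 0\<close> near the complement
  of \<open>Q\<close>, has an image that vanishes at \<open>y\<close>, hence differs from \<open>w\<close> on a neighbourhood of \<open>y\<close>,
  whose points can only correspond to points of \<open>Q\<close> (\<open>corresponds_local\<close>).  This gives uniqueness of
  \<open>x\<close> and continuity of the correspondence at once.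

  Existence of \<open>x\<close> for given \<open>y\<close> is where realcompactness enters (\<open>corresponds_total\<close>).  Compactness
  of the Stone-Cech compactification yields a point \<open>p\<close> none of whose neighbourhoods has a trace on
  \<open>X\<close> that misses a neighbourhood of \<open>y\<close>.  If \<open>p\<close> were outside \<open>X\<close>, there would be a continuous
  real \<open>t\<close> on \<open>X\<close> tending to infinity at \<open>p\<close>.  Glue the preimages of the constants \<open>n w\<close> along
  disjoint bands where \<open>t\<close> is near \<open>4 n\<close>.  The image \<open>T f\<close> of the result is continuous at \<open>y\<close>, so near
  \<open>y\<close> it avoids \<open>n w\<close> for all large \<open>n\<close>: the high bands miss a neighbourhood of \<open>y\<close>.  The same bands
  shifted by 2 cover the gaps, so a whole neighbourhood of \<open>p\<close> has a trace that misses a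
  neighbourhood of \<open>y\<close>, a contradiction.
\<close>

section \<open>Continuous functions into a topological vector space\<close>

lemma tendsto_scaleR_tvs:
  fixes f :: "'x \<Rightarrow> real" and g :: "'x \<Rightarrow> 'e::topological_real_vector"
  assumes "(f \<longlongrightarrow> c) G" "(g \<longlongrightarrow> a) G"
  shows "((\<lambda>x. f x *\<^sub>R g x) \<longlongrightarrow> c *\<^sub>R a) G"
  using filterlim_compose[OF tendsto_scaleR_Pair filterlim_Pair[OF assms]] by simp

text \<open>
  The multiples \<open>n w\<close> escape to infinity without any norm at hand: if \<open>a = n w\<close> is close to \<open>z\<close> and
  \<open>1/n\<close> is close to 0, then \<open>a/n\<close> is close to 0 by joint continuity, but \<open>a/n = w\<close>.
\<close>

lemma multiples_leave_neighbourhood: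
  fixes z w :: "'e::{topological_real_vector,t2_space}"
  assumes "w \<noteq> 0"
  obtains S m where "open S" "z \<in> S" "\<And>n. m \<le> n \<Longrightarrow> real n *\<^sub>R w \<notin> S"
proof -
  have "open (- {w})" by (simp add: open_Compl)
  then have "\<forall>\<^sub>F x in nhds 0 \<times>\<^sub>F nhds z. fst x *\<^sub>R snd x \<in> - {w}"
    using topological_tendstoD[OF tendsto_scaleR_Pair[of "0::real" z], of "- {w}"] assms by auto
  then obtain P Q where P: "eventually P (nhds (0::real))" and Q: "eventually Q (nhds z)"
    and PQ: "\<And>c a. P c \<Longrightarrow> Q a \<Longrightarrow> c *\<^sub>R a \<noteq> w"
    unfolding eventually_prod_filter by auto
  obtain S where S: "open S" "z \<in> S" "\<And>a. a \<in> S \<Longrightarrow> Q a"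
    using Q unfolding eventually_nhds by blast
  have "\<forall>\<^sub>F n in sequentially. P (inverse (real n))"
    using P lim_inverse_n[where 'a=real] unfolding filterlim_iff by blast
  then obtain m where m: "\<And>n. m \<le> n \<Longrightarrow> P (inverse (real n))"
    unfolding eventually_sequentially by blast
  show thesis
  proof (rule that[OF S(1,2)])
    fix n assume "Suc m \<le> n"
    then have "P (inverse (real n))" and "n \<noteq> 0" using m by auto
    then show "real n *\<^sub>R w \<notin> S" using PQ S(3) by fastforce
  qed
qed

lemma cont_funs_restrict:
  "continuous_map X euclidean f \<Longrightarrow> restrict f (topspace X) \<in> cont_funs X"
  by (auto simp: cont_maps_def intro: continuous_map_eq)

lemma cont_funs_continuous: "f \<in> cont_funs X \<Longrightarrow> continuous_map X euclidean f"
  by (simp add: cont_maps_def)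

lemma continuous_map_scaleR_tvs:
  fixes g :: "'a \<Rightarrow> 'e::topological_real_vector"
  assumes "continuous_map X euclideanreal p" "continuous_map X euclidean g"
  shows "continuous_map X euclidean (\<lambda>x. p x *\<^sub>R g x)"
  using assms by (auto simp: continuous_map_atin intro: tendsto_scaleR_tvs)

lemma continuous_map_add_tvs:
  fixes f g :: "'a \<Rightarrow> 'e::topological_real_vector"
  assumes "continuous_map X euclidean f" "continuous_map X euclidean g"
  shows "continuous_map X euclidean (\<lambda>x. f x + g x)"
  using assms by (auto simp: continuous_map_atin intro: tendsto_add)

lemma continuous_map_diff_tvs:
  fixes f g :: "'a \<Rightarrow> 'e::topological_real_vector"
  assumes "continuous_map X euclidean f" "continuous_map X euclidean g"
  shows "continuous_map X euclidean (\<lambda>x. f x - g x)"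
  using assms by (auto simp: continuous_map_atin intro: tendsto_diff)

lemma continuous_map_sum_tvs:
  fixes f :: "'i \<Rightarrow> 'a \<Rightarrow> 'e::topological_real_vector"
  assumes "\<And>i. i \<in> I \<Longrightarrow> continuous_map X euclidean (f i)"
  shows "continuous_map X euclidean (\<lambda>x. \<Sum>i\<in>I. f i x)"
  using assms by (auto simp: continuous_map_atin intro!: tendsto_sum)

lemma openin_cozero_diff:
  fixes f g :: "'a \<Rightarrow> 'e::{topological_real_vector,t2_space}"
  assumes "f \<in> cont_funs X" "g \<in> cont_funs X"
  shows "openin X (cozero X (\<lambda>x. f x - g x))"
proof -
  have "openin X {x \<in> topspace X. f x - g x \<in> - {0}}"
    by (rule openin_continuous_map_preimage[OF continuous_map_diff_tvs])
       (use assms in \<open>auto simp: cont_funs_continuous open_Compl\<close>)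
  then show ?thesis by (simp add: cozero_def)
qed

definition blend ::
    "'a topology \<Rightarrow> ('a \<Rightarrow> real) \<Rightarrow> ('a \<Rightarrow> 'e::real_vector) \<Rightarrow> ('a \<Rightarrow> 'e) \<Rightarrow> 'a \<Rightarrow> 'e" where
  "blend X p h k = (\<lambda>x \<in> topspace X. h x + p x *\<^sub>R (k x - h x))"

lemma blend_in_cont_funs:
  fixes h k :: "'a \<Rightarrow> 'e::topological_real_vector"
  assumes "continuous_map X euclideanreal p" "h \<in> cont_funs X" "k \<in> cont_funs X"
  shows "blend X p h k \<in> cont_funs X"
  unfolding blend_def using assms(1) assms(2,3)[THEN cont_funs_continuous]
  by (intro cont_funs_restrict continuous_map_add_tvs continuous_map_scaleR_tvs
      continuous_map_diff_tvs)

lemma blend_apply [simp]: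
  "x \<in> topspace X \<Longrightarrow> p x = 0 \<Longrightarrow> blend X p h k x = h x"
  "x \<in> topspace X \<Longrightarrow> p x = 1 \<Longrightarrow> blend X p h k x = k x"
  by (simp_all add: blend_def)

definition const_fun :: "'a topology \<Rightarrow> 'e \<Rightarrow> 'a \<Rightarrow> 'e" where
  "const_fun X c = (\<lambda>x \<in> topspace X. c)"

lemma const_fun_in_cont_funs: "const_fun X c \<in> cont_funs X"
  unfolding const_fun_def by (rule cont_funs_restrict) simp

lemma completely_regular_bump:
  assumes "completely_regular_space X" "openin X U" "x \<in> U"
  obtains p where "continuous_map X euclideanreal p" "p x = (1::real)"
    "\<And>z. z \<in> topspace X - U \<Longrightarrow> p z = 0"
proof -
  have "closedin X (topspace X - U)" "x \<in> topspace X - (topspace X - U)"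
    using assms openin_subset by auto
  then obtain q where q: "continuous_map X (top_of_set {0..1::real}) q" "q x = 0"
      "q ` (topspace X - U) \<subseteq> {1}"
    using assms(1) unfolding completely_regular_space_def by metis
  show thesis
  proof (rule that[of "\<lambda>z. 1 - q z"])
    show "continuous_map X euclideanreal (\<lambda>z. 1 - q z)"
      using q(1) by (intro continuous_map_diff) (auto simp: continuous_map_in_subtopology)
  qed (use q in auto)
qed

text \<open>
  A bump function with flat top and flat bottom: functions blended along it agree with the two
  ingredients on open sets, and only agreement on open sets is visible to a biseparating map.
\<close>

lemma completely_regular_plateau:
  assumes "completely_regular_space X" "openin X U" "x \<in> U"
  obtains p W W' where "continuous_map X euclideanreal p"
    "openin X W" "x \<in> W" "W \<subseteq> U" "\<And>z. z \<in> W \<Longrightarrow> p z = (1::real)"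
    "openin X W'" "topspace X - U \<subseteq> W'" "\<And>z. z \<in> W' \<Longrightarrow> p z = 0"
proof -
  obtain q where q: "continuous_map X euclideanreal q" "q x = (1::real)"
    "\<And>z. z \<in> topspace X - U \<Longrightarrow> q z = 0"
    using completely_regular_bump[OF assms] by metis
  define p where "p = (\<lambda>z. max 0 (min 1 (3 * q z - 1)))"
  show thesis
  proof (rule that)
    show "continuous_map X euclideanreal p"
      unfolding p_def using q(1)
      by (auto simp: continuous_map_atin intro!: tendsto_intros)
    show "openin X {z \<in> topspace X. q z \<in> {2/3<..}}" "openin X {z \<in> topspace X. q z \<in> {..<1/3}}"
      by (rule openin_continuous_map_preimage[OF q(1)]; simp)+
    show "x \<in> {z \<in> topspace X. q z \<in> {2/3<..}}"
      using q(2) assms(2,3) openin_subset by fastforce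
    show "{z \<in> topspace X. q z \<in> {2/3<..}} \<subseteq> U" using q(3) by fastforce
    show "topspace X - U \<subseteq> {z \<in> topspace X. q z \<in> {..<1/3}}" using q(3) by auto
  qed (auto simp: p_def)
qed

text \<open>
  Width and spacing are balanced: the bands leave room for cutoff functions with disjoint supports,
  yet the bands of \<open>t\<close> and of \<open>t - 2\<close> together cover the part of the space where \<open>t\<close> is large.
\<close>

definition level_band :: "'a topology \<Rightarrow> ('a \<Rightarrow> real) \<Rightarrow> nat \<Rightarrow> 'a set" where
  "level_band X t n = {x \<in> topspace X. \<bar>t x - 4 * real n\<bar> < 3/2}"

lemma openin_level_band:
  assumes "continuous_map X euclideanreal t"
  shows "openin X (level_band X t n)"
proof -
  have "continuous_map X euclideanreal (\<lambda>x. \<bar>t x - 4 * real n\<bar>)"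
    using assms by (auto simp: continuous_map_atin intro!: tendsto_intros)
  then have "openin X {x \<in> topspace X. \<bar>t x - 4 * real n\<bar> \<in> {..<3/2}}"
    by (rule openin_continuous_map_preimage) simp
  then show ?thesis by (simp add: level_band_def)
qed

text \<open>
  Each \<open>h n\<close> is cut off outside \<open>\<bar>t - 4 n\<bar> < 2\<close>.  The cutoffs have disjoint, locally finite supports
  because \<open>t\<close> is locally bounded, so their sum is continuous.
\<close>

lemma glue_along_levels:
  fixes h :: "nat \<Rightarrow> 'a \<Rightarrow> 'e::topological_real_vector"
  assumes t: "continuous_map X euclideanreal t" and h: "\<And>n. h n \<in> cont_funs X"
  obtains f where "f \<in> cont_funs X"
    "\<And>n x. x \<in> level_band X t n \<Longrightarrow> f x = h n x"
proof -
  define b where "b n x = max 0 (min 1 (4 - 2 * \<bar>t x - 4 * real n\<bar>))" for n x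
  have b_cont: "continuous_map X euclideanreal (b n)" for n
    unfolding b_def using t by (auto simp: continuous_map_atin intro!: tendsto_intros)
  have b0: "b n x = 0" if "\<bar>t x - 4 * real n\<bar> \<ge> 2" for n x
    using that by (simp add: b_def)
  define f where "f x = (\<Sum>n\<le>nat \<lceil>t x\<rceil>. b n x *\<^sub>R h n x)" for x
  \<comment> \<open>Terms with \<open>n \<ge> t x\<close> and \<open>n \<ge> 1\<close> vanish, so the upper limit may be enlarged to one that works
    on a whole neighbourhood.\<close>
  have f_eq: "f x = (\<Sum>n\<le>M. b n x *\<^sub>R h n x)" if "t x < real M" for x M
    unfolding f_def
  proof (rule sum.mono_neutral_left)
    show "{..nat \<lceil>t x\<rceil>} \<subseteq> {..M}" using that by (auto simp: nat_le_iff) linarith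
    show "\<forall>n\<in>{..M} - {..nat \<lceil>t x\<rceil>}. b n x *\<^sub>R h n x = 0"
    proof
      fix n assume "n \<in> {..M} - {..nat \<lceil>t x\<rceil>}"
      then have "t x \<le> real n" "1 \<le> real n" by (auto simp: not_le) linarith+
      then show "b n x *\<^sub>R h n x = 0" using b0[of x n] by simp
    qed
  qed simp
  have "continuous_map X euclidean f"
    unfolding continuous_map_atin limitin_canonical_iff
  proof
    fix x assume x: "x \<in> topspace X"
    obtain M where M: "t x < real M" using reals_Archimedean2 by blast
    have "((\<lambda>x. \<Sum>n\<le>M. b n x *\<^sub>R h n x) \<longlongrightarrow> (\<Sum>n\<le>M. b n x *\<^sub>R h n x)) (atin X x)"
      using continuous_map_sum_tvs[of "{..M}" X "\<lambda>n x. b n x *\<^sub>R h n x"]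
        continuous_map_scaleR_tvs[OF b_cont cont_funs_continuous[OF h]] x
      by (simp add: continuous_map_atin)
    moreover have "\<forall>\<^sub>F z in atin X x. (\<Sum>n\<le>M. b n z *\<^sub>R h n z) = f z"
    proof -
      have "(t \<longlongrightarrow> t x) (atin X x)" using t x by (simp add: continuous_map_atin)
      then have "\<forall>\<^sub>F z in atin X x. t z < real M" using M by (rule order_tendstoD)
      then show ?thesis by eventually_elim (simp add: f_eq)
    qed
    ultimately show "(f \<longlongrightarrow> f x) (atin X x)"
      using f_eq[OF M] by (simp add: Lim_transform_eventually)
  qed
  moreover have "f x = h n x" if "\<bar>t x - 4 * real n\<bar> < 3/2" for n x
  proof -
    obtain M0 where "t x < real M0" using reals_Archimedean2 by blast
    then have M: "t x < real (max M0 n)" by simp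
    have "b k x = (if k = n then 1 else 0)" for k
    proof (cases "k = n")
      case True then show ?thesis using that by (simp add: b_def)
    next
      case False
      then have "\<bar>real k - real n\<bar> \<ge> 1" by linarith
      then have "\<bar>t x - 4 * real k\<bar> \<ge> 2" using that by linarith
      then show ?thesis using b0 False by simp
    qed
    then have "f x = (\<Sum>k\<le>max M0 n. if k = n then h n x else 0)"
      unfolding f_eq[OF M] by (intro sum.cong) auto
    then show ?thesis by simp
  qed
  ultimately show thesis
    by (intro that[of "restrict f (topspace X)"] cont_funs_restrict)
       (auto simp: level_band_def)
qed

section \<open>Sets that a biseparating map does not see\<close>

locale biseparating_map =
  fixes X :: "'a topology" and Y :: "'b topology"
    and T :: "('a \<Rightarrow> 'e::{topological_real_vector,t2_space}) \<Rightarrow>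
              ('b \<Rightarrow> 'f::{topological_real_vector,t2_space})"
  assumes X_Hausdorff: "Hausdorff_space X" and X_cr: "completely_regular_space X"
    and Y_Hausdorff: "Hausdorff_space Y" and Y_cr: "completely_regular_space Y"
    and E_nontrivial: "\<exists>v::'e. v \<noteq> 0" and F_nontrivial: "\<exists>w::'f. w \<noteq> 0"
    and T_bisep: "biseparating X Y T"
begin

abbreviation S where "S \<equiv> inv_into (cont_funs X) T"

lemma T_bij: "bij_betw T (cont_funs X) (cont_funs Y)"
  using T_bisep by (simp add: biseparating_def)

lemma T_in: "f \<in> cont_funs X \<Longrightarrow> T f \<in> cont_funs Y"
  using T_bij by (rule bij_betw_apply)

lemma S_in: "g \<in> cont_funs Y \<Longrightarrow> S g \<in> cont_funs X"
  using bij_betw_inv_into[OF T_bij] by (rule bij_betw_apply)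

lemma T_S: "g \<in> cont_funs Y \<Longrightarrow> T (S g) = g"
  using T_bij by (rule bij_betw_inv_into_right)

lemma S_T: "f \<in> cont_funs X \<Longrightarrow> S (T f) = f"
  using T_bij by (rule bij_betw_inv_into_left)

lemma T_disjoint:
  assumes "f \<in> cont_funs X" "g \<in> cont_funs X" "h \<in> cont_funs X"
  shows "(\<forall>x\<in>topspace X. f x = h x \<or> g x = h x) \<longleftrightarrow>
         (\<forall>y\<in>topspace Y. T f y = T h y \<or> T g y = T h y)"
proof -
  have "disjoint_rel X h f g \<longleftrightarrow> disjoint_rel Y (T h) (T f) (T g)"
    using T_bisep assms by (simp add: biseparating_def)
  then show ?thesis by (auto simp: disjoint_rel_def cozero_def)
qed

lemma T_S_const: "y \<in> topspace Y \<Longrightarrow> T (S (const_fun Y c)) y = c"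
  by (simp add: T_S const_fun_in_cont_funs) (simp add: const_fun_def)

lemma inverse: "biseparating_map Y X S"
proof
  have "disjoint_rel Y h f g \<longleftrightarrow> disjoint_rel X (S h) (S f) (S g)"
    if "f \<in> cont_funs Y" "g \<in> cont_funs Y" "h \<in> cont_funs Y" for f g h
    using T_bisep S_in[OF that(1)] S_in[OF that(2)] S_in[OF that(3)] that
    by (simp add: biseparating_def T_S)
  then show "biseparating Y X S"
    using bij_betw_inv_into[OF T_bij] by (simp add: biseparating_def)
qed (fact X_Hausdorff X_cr Y_Hausdorff Y_cr E_nontrivial F_nontrivial)+

lemma inverse_inverse:
  assumes "f \<in> cont_funs X"
  shows "inv_into (cont_funs Y) S f = T f"
proof -
  interpret inv: biseparating_map Y X S by (rule inverse)
  show ?thesis using inv.S_T[OF T_in[OF assms]] by (simp add: S_T assms)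
qed

text \<open>
  The definition singles out a base point \<open>h\<close>, since the separation hypothesis only compares
  functions with a common base point.  That the choice of \<open>h\<close> does not matter is proved below.
\<close>

definition misses_at :: "('a \<Rightarrow> 'e) \<Rightarrow> 'a set \<Rightarrow> 'b set \<Rightarrow> bool" where
  "misses_at h U V \<longleftrightarrow>
     (\<forall>f \<in> cont_funs X. (\<forall>x \<in> topspace X - U. f x = h x) \<longrightarrow> (\<forall>y\<in>V. T f y = T h y))"

lemma misses_atD:
  assumes "misses_at h U V" "f \<in> cont_funs X" "\<And>x. x \<in> topspace X \<Longrightarrow> x \<notin> U \<Longrightarrow> f x = h x" "y \<in> V"
  shows "T f y = T h y"
  using assms by (simp add: misses_at_def)

lemma misses_at_mono:
  "misses_at h U V \<Longrightarrow> U' \<subseteq> U \<Longrightarrow> V' \<subseteq> V \<Longrightarrow> misses_at h U' V'"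
  unfolding misses_at_def by blast

text \<open>
  A function that differs from \<open>g\<close> only inside \<open>U\<close> is disjoint from \<open>f\<close> relative to \<open>g\<close>, because
  \<open>f\<close> differs from \<open>g\<close> only outside \<open>U\<close>.
\<close>

lemma agree_misses_at:
  assumes f: "f \<in> cont_funs X" and g: "g \<in> cont_funs X" and eq: "\<And>x. x \<in> U \<Longrightarrow> f x = g x"
  shows "misses_at g U (cozero Y (\<lambda>y. T f y - T g y))"
  unfolding misses_at_def
proof (intro ballI impI)
  fix k y
  assume k: "k \<in> cont_funs X" "\<forall>x\<in>topspace X - U. k x = g x"
    and y: "y \<in> cozero Y (\<lambda>y. T f y - T g y)"
  have "\<forall>x\<in>topspace X. k x = g x \<or> f x = g x" using k(2) eq by blast
  then show "T k y = T g y" using T_disjoint[OF k(1) f g] y by (auto simp: cozero_def)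
qed

text \<open>
  Changing the base point at the cost of shrinking \<open>U\<close> to \<open>W\<close>.  Let \<open>f\<close> and \<open>k\<close> agree off \<open>W\<close> and
  suppose \<open>T f\<close> and \<open>T k\<close> differ at \<open>y \<in> V\<close>.  The blend that is \<open>k\<close> on \<open>W\<close> and \<open>h\<close> off \<open>U\<close> has the
  same image as \<open>h\<close> at \<open>y\<close>, since \<open>U\<close> misses \<open>V\<close> at \<open>h\<close>; it also has the same image as \<open>k\<close> at
  \<open>y\<close>, for otherwise \<open>W\<close> would miss \<open>y\<close> at \<open>k\<close>, making \<open>T f y = T k y\<close>.  So \<open>T h y = T k y\<close>.
  The same argument with \<open>f\<close> and \<open>k\<close> exchanged gives \<open>T h y = T f y\<close>, a contradiction.
\<close>

lemma misses_at_shrink: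
  assumes h: "h \<in> cont_funs X" and k: "k \<in> cont_funs X"
    and miss: "misses_at h U V" and V: "V \<subseteq> topspace Y"
    and p: "continuous_map X euclideanreal p"
      "\<And>x. x \<in> W \<Longrightarrow> p x = 1" "\<And>x. x \<in> topspace X - U \<Longrightarrow> p x = 0"
    and W: "W \<subseteq> topspace X"
  shows "misses_at k W V"
  unfolding misses_at_def
proof (intro ballI impI)
  fix f y assume f: "f \<in> cont_funs X" and fk: "\<forall>x\<in>topspace X - W. f x = k x" and y: "y \<in> V"
  have key: "T h y = T k' y"
    if "k' \<in> cont_funs X" "f' \<in> cont_funs X" "\<forall>x\<in>topspace X - W. f' x = k' x" "T f' y \<noteq> T k' y"
    for f' k'
  proof -
    have B: "blend X p h k' \<in> cont_funs X" by (rule blend_in_cont_funs[OF p(1) h that(1)])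
    have "T (blend X p h k') y = T h y"
      by (rule misses_atD[OF miss B _ y]) (use p(3) in auto)
    moreover have "misses_at k' W (cozero Y (\<lambda>y. T (blend X p h k') y - T k' y))"
      by (rule agree_misses_at[OF B that(1)]) (use p(2) W in auto)
    then have "T (blend X p h k') y = T k' y"
      using that y V by (auto simp: misses_at_def cozero_def)
    ultimately show ?thesis by simp
  qed
  show "T f y = T k y"
  proof (rule ccontr)
    assume ne: "T f y \<noteq> T k y"
    have "T h y = T k y" using key[OF k f] fk ne by blast
    moreover have "T h y = T f y" using key[OF f k] fk ne by metis
    ultimately show False using ne by simp
  qed
qed

text \<open>
  Let \<open>g\<close> be such that \<open>T g\<close> differs from \<open>T h\<close> only inside \<open>V\<close>, and suppose \<open>g\<close> differs from \<open>h\<close> at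
  a point of \<open>U\<close>.  A small bump added to \<open>h\<close> there gives a function that is not disjoint from \<open>g\<close>
  relative to \<open>h\<close> and whose image is that of \<open>h\<close> on \<open>V\<close>, hence disjoint from \<open>T g\<close> relative to
  \<open>T h\<close>.
\<close>

lemma misses_at_inverse:
  assumes U: "openin X U" and V: "V \<subseteq> topspace Y" and h: "h \<in> cont_funs X"
    and miss: "misses_at h U V"
  shows "biseparating_map.misses_at Y S (T h) V U"
proof -
  interpret inv: biseparating_map Y X S by (rule inverse)
  show ?thesis
    unfolding inv.misses_at_def
  proof (intro ballI impI, rule ccontr)
    fix g' x assume g': "g' \<in> cont_funs Y" "\<forall>y\<in>topspace Y - V. g' y = T h y"
      and x: "x \<in> U" and ne: "S g' x \<noteq> S (T h) x"
    define g where "g = S g'"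
    have g: "g \<in> cont_funs X" "T g = g'" and gx: "g x \<noteq> h x"
      using g' ne h by (auto simp: g_def S_in T_S S_T)
    have xX: "x \<in> topspace X" using U x openin_subset by blast
    obtain v :: 'e where v: "v \<noteq> 0" using E_nontrivial by blast
    define D where "D = U \<inter> cozero X (\<lambda>x. g x - h x)"
    have D: "openin X D" unfolding D_def using U g h by (intro openin_Int openin_cozero_diff)
    have xD: "x \<in> D" unfolding D_def using x gx xX by (simp add: cozero_def)
    obtain p where p: "continuous_map X euclideanreal p" "p x = (1::real)"
        "\<And>z. z \<in> topspace X - D \<Longrightarrow> p z = 0"
      using completely_regular_bump[OF X_cr D xD] by blast
    define f where "f = restrict (\<lambda>x. h x + p x *\<^sub>R v) (topspace X)"
    have f: "f \<in> cont_funs X"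
      unfolding f_def using p(1) cont_funs_continuous[OF h]
      by (intro cont_funs_restrict continuous_map_add_tvs continuous_map_scaleR_tvs) auto
    have "f x \<noteq> h x" using p(2) v xX by (simp add: f_def)
    then have "\<not> (\<forall>z\<in>topspace X. f z = h z \<or> g z = h z)" using gx xX by blast
    then obtain y where y: "y \<in> topspace Y" "T f y \<noteq> T h y" "T g y \<noteq> T h y"
      using T_disjoint[OF f g(1) h] by auto
    then have "y \<in> V" using g' g(2) by auto
    then have "T f y = T h y"
      by (rule misses_atD[OF miss f, rotated]) (use p(3) in \<open>simp add: f_def D_def\<close>)
    then show False using y(2) by simp
  qed
qed

lemma misses_at_inverse_iff:
  assumes U: "openin X U" and V: "openin Y V" and h: "h \<in> cont_funs X"
  shows "biseparating_map.misses_at Y S (T h) V U \<longleftrightarrow> misses_at h U V"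
proof
  interpret inv: biseparating_map Y X S by (rule inverse)
  assume "inv.misses_at (T h) V U"
  then have "biseparating_map.misses_at X inv.S (S (T h)) U V"
    using inv.misses_at_inverse[OF V openin_subset[OF U] T_in[OF h]] by blast
  then have *: "inv.S f y = inv.S h y"
    if "f \<in> cont_funs X" "\<forall>x\<in>topspace X - U. f x = h x" "y \<in> V" for f y
    using that unfolding biseparating_map.misses_at_def[OF inv.inverse] S_T[OF h] by blast
  show "misses_at h U V"
    unfolding misses_at_def
  proof (intro ballI impI)
    fix f y
    assume f: "f \<in> cont_funs X" and "\<forall>x\<in>topspace X - U. f x = h x" "y \<in> V"
    then show "T f y = T h y"
      using *[of f y] by (simp only: inverse_inverse[OF f] inverse_inverse[OF h])
  qed
qed (rule misses_at_inverse[OF U openin_subset[OF V] h])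

text \<open>
  Unions are hard on the side of \<open>X\<close>, where one would have to decompose a change of functions, but
  trivial for the inverse map, where \<open>U\<close> is the set on which two functions have to agree.
\<close>

lemma misses_at_Union:
  assumes \<U>: "\<And>U. U \<in> \<U> \<Longrightarrow> openin X U \<and> misses_at h U V"
    and V: "openin Y V" and h: "h \<in> cont_funs X"
  shows "misses_at h (\<Union>\<U>) V"
proof -
  interpret inv: biseparating_map Y X S by (rule inverse)
  have "inv.misses_at (T h) V U" if "U \<in> \<U>" for U
    using \<U>[OF that] misses_at_inverse_iff[OF _ V h, of U] by simp
  then have "inv.misses_at (T h) V (\<Union>\<U>)"
    unfolding inv.misses_at_def by blast
  moreover have "openin X (\<Union>\<U>)" using \<U> by (intro openin_Union) simp
  ultimately show ?thesis using misses_at_inverse_iff[OF _ V h] by simp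
qed

text \<open>By complete regularity \<open>U\<close> is the union of the sets \<open>W\<close> to which shrinking applies.\<close>

lemma misses_at_change_base:
  assumes U: "openin X U" and V: "openin Y V" and h: "h \<in> cont_funs X" and k: "k \<in> cont_funs X"
    and miss: "misses_at h U V"
  shows "misses_at k U V"
proof -
  let ?\<W> = "{W. openin X W \<and> W \<subseteq> U \<and> misses_at k W V}"
  have "\<exists>W\<in>?\<W>. x \<in> W" if x: "x \<in> U" for x
  proof -
    obtain p W W' where p: "continuous_map X euclideanreal p"
      "openin X W" "x \<in> W" "W \<subseteq> U" "\<And>z. z \<in> W \<Longrightarrow> p z = (1::real)"
      "topspace X - U \<subseteq> W'" "\<And>z. z \<in> W' \<Longrightarrow> p z = 0"
      using completely_regular_plateau[OF X_cr U x] by metis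
    have "misses_at k W V"
      by (rule misses_at_shrink[OF h k miss openin_subset[OF V] p(1)])
         (use p openin_subset[OF p(2)] in auto)
    then show ?thesis using p by blast
  qed
  then have "\<Union>?\<W> = U" by blast
  moreover have "misses_at k (\<Union>?\<W>) V" by (rule misses_at_Union[OF _ V k]) simp
  ultimately show ?thesis by simp
qed

definition misses :: "'a set \<Rightarrow> 'b set \<Rightarrow> bool" where
  "misses U V \<longleftrightarrow> (\<forall>h \<in> cont_funs X. misses_at h U V)"

lemma missesI:
  "openin X U \<Longrightarrow> openin Y V \<Longrightarrow> h \<in> cont_funs X \<Longrightarrow> misses_at h U V \<Longrightarrow> misses U V"
  unfolding misses_def using misses_at_change_base by blast

lemma misses_mono: "misses U V \<Longrightarrow> U' \<subseteq> U \<Longrightarrow> V' \<subseteq> V \<Longrightarrow> misses U' V'"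
  unfolding misses_def using misses_at_mono by blast

lemma misses_Union:
  "(\<And>U. U \<in> \<U> \<Longrightarrow> openin X U \<and> misses U V) \<Longrightarrow> openin Y V \<Longrightarrow> misses (\<Union>\<U>) V"
  unfolding misses_def using misses_at_Union by blast

lemma misses_inverse_iff:
  assumes U: "openin X U" and V: "openin Y V"
  shows "biseparating_map.misses Y S V U \<longleftrightarrow> misses U V"
proof -
  interpret inv: biseparating_map Y X S by (rule inverse)
  have "cont_funs Y = T ` cont_funs X" using T_bij by (simp add: bij_betw_def)
  then show ?thesis
    unfolding inv.misses_def misses_def using misses_at_inverse_iff[OF U V] by simp
qed

lemma agree_misses:
  assumes f: "f \<in> cont_funs X" and g: "g \<in> cont_funs X" and eq: "\<And>x. x \<in> U \<Longrightarrow> f x = g x"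
    and U: "openin X U"
  shows "misses U (cozero Y (\<lambda>y. T f y - T g y))"
  by (rule missesI[OF U _ g agree_misses_at[OF f g eq]])
     (use f g in \<open>auto intro: openin_cozero_diff T_in\<close>)

section \<open>The correspondence between points\<close>

definition corresponds :: "'a \<Rightarrow> 'b \<Rightarrow> bool" where
  "corresponds x y \<longleftrightarrow> x \<in> topspace X \<and> y \<in> topspace Y \<and>
     (\<forall>U V. openin X U \<longrightarrow> x \<in> U \<longrightarrow> openin Y V \<longrightarrow> y \<in> V \<longrightarrow> \<not> misses U V)"

lemma corresponds_inverse_iff:
  "biseparating_map.corresponds Y X S y x \<longleftrightarrow> corresponds x y"
proof -
  interpret inv: biseparating_map Y X S by (rule inverse)
  show ?thesis
    unfolding inv.corresponds_def corresponds_def using misses_inverse_iff by blast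
qed

text \<open>
  The value of \<open>T f\<close> at \<open>y\<close> depends only on \<open>f\<close> near a corresponding point \<open>x\<close>.  So if \<open>f\<close> is the
  preimage of 0 near \<open>x\<close> and of \<open>w\<close> near the complement of \<open>Q\<close>, the values 0 and \<open>w\<close> of \<open>T f\<close>
  tell apart the points of \<open>Y\<close> that correspond to the two regions.
\<close>

lemma corresponds_local:
  assumes xy: "corresponds x y" and Q: "openin X Q" "x \<in> Q"
  obtains V where "openin Y V" "y \<in> V" "\<And>x' y'. y' \<in> V \<Longrightarrow> corresponds x' y' \<Longrightarrow> x' \<in> Q"
proof -
  obtain w :: 'f where w: "w \<noteq> 0" using F_nontrivial by blast
  obtain p W W' where p: "continuous_map X euclideanreal p"
    "openin X W" "x \<in> W" "\<And>z. z \<in> W \<Longrightarrow> p z = (1::real)"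
    "openin X W'" "topspace X - Q \<subseteq> W'" "\<And>z. z \<in> W' \<Longrightarrow> p z = 0"
    using completely_regular_plateau[OF X_cr Q] by metis
  let ?c0 = "const_fun Y (0::'f)" and ?cw = "const_fun Y w"
  define f where "f = blend X p (S ?cw) (S ?c0)"
  have in0: "S ?c0 \<in> cont_funs X" and inw: "S ?cw \<in> cont_funs X"
    by (auto intro: S_in const_fun_in_cont_funs)
  have f: "f \<in> cont_funs X" unfolding f_def by (rule blend_in_cont_funs[OF p(1) inw in0])
  define V where "V = cozero Y (\<lambda>y. T f y - T (S ?cw) y)"
  have yY: "y \<in> topspace Y" using xy by (simp add: corresponds_def)
  have "misses W (cozero Y (\<lambda>y. T f y - T (S ?c0) y))"
    by (rule agree_misses[OF f in0 _ p(2)]) (use p openin_subset in \<open>fastforce simp: f_def\<close>)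
  moreover have "openin Y (cozero Y (\<lambda>y. T f y - T (S ?c0) y))"
    by (intro openin_cozero_diff T_in f in0)
  ultimately have "y \<notin> cozero Y (\<lambda>y. T f y - T (S ?c0) y)"
    using xy p(2,3) unfolding corresponds_def by blast
  then have "T f y = 0" using yY by (simp add: cozero_def T_S_const)
  then have yV: "y \<in> V" using yY w by (simp add: V_def cozero_def T_S_const)
  have V: "openin Y V" unfolding V_def by (intro openin_cozero_diff T_in f inw)
  have miss: "misses W' V"
    unfolding V_def
    by (rule agree_misses[OF f inw _ p(5)]) (use p openin_subset in \<open>fastforce simp: f_def\<close>)
  show thesis
  proof (rule that[OF V yV])
    fix x' y' assume "y' \<in> V" "corresponds x' y'"
    then have "x' \<notin> W'" "x' \<in> topspace X" using miss V p(5) unfolding corresponds_def by blast+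
    then show "x' \<in> Q" using p(6) by blast
  qed
qed

lemma corresponds_unique:
  assumes "corresponds x y" "corresponds x' y"
  shows "x' = x"
proof (rule ccontr)
  assume ne: "x' \<noteq> x"
  have xs: "x \<in> topspace X" "x' \<in> topspace X" using assms by (simp_all add: corresponds_def)
  let ?Q = "topspace X - {x'}"
  have "openin X ?Q"
    using closedin_Hausdorff_singleton[OF X_Hausdorff xs(2)] by blast
  moreover have "x \<in> ?Q" using xs ne by blast
  ultimately obtain V where V: "y \<in> V" "\<And>z y'. y' \<in> V \<Longrightarrow> corresponds z y' \<Longrightarrow> z \<in> ?Q"
    using corresponds_local[OF assms(1)] by metis
  show False using V(2)[OF V(1) assms(2)] by blast
qed

text \<open>
  The glued function is \<open>S\<close> of the constant \<open>n w\<close> on the band of level \<open>n\<close>, so that band misses the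
  set where \<open>T f \<noteq> n w\<close>.  For all large \<open>n\<close> these sets contain a common neighbourhood of \<open>y\<close>.
\<close>

lemma misses_high_levels:
  assumes t: "continuous_map X euclideanreal t" and y: "y \<in> topspace Y"
  obtains V m where "openin Y V" "y \<in> V"
    "misses (\<Union>n\<in>{m..}. level_band X t n) V"
proof -
  obtain w :: 'f where w: "w \<noteq> 0" using F_nontrivial by blast
  define c where "c n = S (const_fun Y (real n *\<^sub>R w))" for n
  have c: "c n \<in> cont_funs X" for n unfolding c_def by (intro S_in const_fun_in_cont_funs)
  obtain f where f: "f \<in> cont_funs X"
    and f_eq: "\<And>n x. x \<in> level_band X t n \<Longrightarrow> f x = c n x"
    using glue_along_levels[of X t c, OF t c] by blast
  obtain N m where N: "open N" "T f y \<in> N" "\<And>n. m \<le> n \<Longrightarrow> real n *\<^sub>R w \<notin> N"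
    using multiples_leave_neighbourhood[OF w] by blast
  define V where "V = {z \<in> topspace Y. T f z \<in> N}"
  have V: "openin Y V"
    unfolding V_def using N(1) by (intro openin_continuous_map_preimage[OF cont_funs_continuous[OF T_in[OF f]]]) simp
  have A: "openin X (level_band X t n)" for n by (rule openin_level_band[OF t])
  have "misses (level_band X t n) V" if "m \<le> n" for n
  proof (rule misses_mono[OF agree_misses[OF f c[of n] _ A[of n]] subset_refl])
    show "V \<subseteq> cozero Y (\<lambda>y. T f y - T (c n) y)"
      using N(3)[OF that] by (auto simp: V_def cozero_def c_def T_S_const)
  qed (use f_eq in auto)
  then have "misses (\<Union>n\<in>{m..}. level_band X t n) V" using A by (intro misses_Union[OF _ V]) auto
  moreover have "y \<in> V" using y N(2) by (simp add: V_def)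
  ultimately show thesis using that V by blast
qed

text \<open>
  The open sets that miss some neighbourhood of \<open>y\<close> form a proper ideal.  A compactness argument
  therefore finds a point \<open>p\<close> of the Stone-Cech compactification whose
  neighbourhoods have no trace in this ideal, and realcompactness brings \<open>p\<close> into \<open>X\<close>.
\<close>

lemma corresponds_total:
  assumes rc: "realcompact_space X" and y: "y \<in> topspace Y"
  shows "\<exists>x. corresponds x y"
proof -
  define null where "null U \<longleftrightarrow> (\<exists>V. openin Y V \<and> y \<in> V \<and> misses U V)" for U
  have null_mono: "null U'" if "null U" "U' \<subseteq> U" for U U'
    using that misses_mono unfolding null_def by blast
  have null_Union: "null (\<Union>\<U>)" if fin: "finite \<U>" and null_open: "\<And>U. U \<in> \<U> \<Longrightarrow> openin X U \<and> null U" for \<U>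
  proof -
    obtain V where V: "\<And>U. U \<in> \<U> \<Longrightarrow> openin Y (V U) \<and> y \<in> V U \<and> misses U (V U)"
      using null_open unfolding null_def by metis
    define V0 where "V0 = topspace Y \<inter> \<Inter>(V ` \<U>)"
    have "openin Y V0"
      unfolding V0_def using V fin by (intro openin_Int_Inter) auto
    moreover have "y \<in> V0" using V y by (auto simp: V0_def)
    moreover have "misses U V0" if "U \<in> \<U>" for U
      using misses_mono[of U "V U" U V0] V[OF that] that by (auto simp: V0_def)
    ultimately show ?thesis
      unfolding null_def using misses_Union[of \<U> V0] null_open by blast
  qed
  have not_null: "\<not> null (topspace X)"
  proof
    assume "null (topspace X)"
    then obtain V where V: "y \<in> V" "misses (topspace X) V" unfolding null_def by blast
    obtain w :: 'f where w: "w \<noteq> 0" using F_nontrivial by blast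
    have "T (S (const_fun Y w)) y = T (S (const_fun Y 0)) y"
      using V S_in[OF const_fun_in_cont_funs] unfolding misses_def misses_at_def by blast
    then show False using w y by (simp add: T_S_const)
  qed
  let ?B = "stone_cech X" and ?e = "stone_cech_map X"
  define trace where "trace N = {x \<in> topspace X. ?e x \<in> N}" for N
  have trace_open: "openin X (trace N)" if "openin ?B N" for N
    unfolding trace_def
    by (rule openin_continuous_map_preimage[OF continuous_map_stone_cech that])
  obtain p where p: "p \<in> topspace ?B" "\<And>N. openin ?B N \<Longrightarrow> p \<in> N \<Longrightarrow> \<not> null (trace N)"
  proof (rule ccontr)
    assume "\<not> thesis"
    then have "\<forall>p\<in>topspace ?B. \<exists>N. openin ?B N \<and> p \<in> N \<and> null (trace N)" using that by blast
    then have "topspace ?B \<subseteq> \<Union>{N. openin ?B N \<and> null (trace N)}" by blast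
    then obtain \<F> where \<F>: "finite \<F>" "\<F> \<subseteq> {N. openin ?B N \<and> null (trace N)}" "topspace ?B \<subseteq> \<Union>\<F>"
      using compact_space_stone_cech[of X] unfolding compact_space_alt
      by (metis (no_types, lifting) mem_Collect_eq)
    have "null (\<Union>(trace ` \<F>))"
      using \<F>(1,2) trace_open by (intro null_Union) auto
    moreover have "topspace X \<subseteq> \<Union>(trace ` \<F>)"
      using \<F>(3) continuous_map_image_subset_topspace[OF continuous_map_stone_cech[of X]]
      by (auto simp: trace_def)
    ultimately show False using not_null null_mono by blast
  qed
  have "p \<in> ?e ` topspace X"
  proof (rule ccontr)
    assume "p \<notin> ?e ` topspace X"
    then obtain u where u: "continuous_map ?B unit_interval u" "u p = 1"
        "\<And>x. x \<in> topspace X \<Longrightarrow> u (?e x) < 1"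
      using rc p(1) unfolding realcompact_space_def by blast
    have uc: "continuous_map ?B euclideanreal u"
      using u(1) by (simp add: continuous_map_in_subtopology)
    have ue: "continuous_map X euclideanreal (\<lambda>x. u (?e x))"
      using continuous_map_compose[OF continuous_map_stone_cech uc] by (simp add: o_def)
    \<comment> \<open>Real-valued on \<open>X\<close>, and larger than any \<open>M\<close> on the trace of a neighbourhood of \<open>p\<close>.\<close>
    define t where "t x = 1 / (1 - u (?e x))" for x
    have t: "continuous_map X euclideanreal t"
      using ue u(3) unfolding t_def
      by (auto simp: continuous_map_atin intro!: tendsto_intros) force
    have t2: "continuous_map X euclideanreal (\<lambda>x. t x - 2)"
      using t by (auto simp: continuous_map_atin intro!: tendsto_intros)
    let ?A = "\<lambda>t m. \<Union>n\<in>{m..}. level_band X t n"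
    obtain V1 m1 where 1: "openin Y V1" "y \<in> V1" "misses (?A t m1) V1"
      using misses_high_levels[OF t y] by blast
    obtain V2 m2 where 2: "openin Y V2" "y \<in> V2" "misses (?A (\<lambda>x. t x - 2) m2) V2"
      using misses_high_levels[OF t2 y] by blast
    have A_open: "openin X (?A t m)" if "continuous_map X euclideanreal t" for t m
      using openin_level_band[OF that] by blast
    have null12: "null (\<Union>{?A t m1, ?A (\<lambda>x. t x - 2) m2})"
      by (rule null_Union) (use 1 2 A_open[OF t] A_open[OF t2] null_def in auto)
    \<comment> \<open>Above \<open>M\<close> every value of \<open>t\<close> lies in a band of level at least \<open>m1\<close>, or in a shifted band of
      level at least \<open>m2\<close>.\<close>
    define M where "M = 4 * real (m1 + m2 + 1)"
    define N where "N = {q \<in> topspace ?B. u q \<in> {1 - 1 / M<..}}"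
    have "M > 0" by (simp add: M_def)
    have "openin ?B N" unfolding N_def by (rule openin_continuous_map_preimage[OF uc]) simp
    moreover have "p \<in> N" using p(1) u(2) \<open>M > 0\<close> by (simp add: N_def)
    moreover have "trace N \<subseteq> \<Union>{?A t m1, ?A (\<lambda>x. t x - 2) m2}"
    proof
      fix x assume "x \<in> trace N"
      then have x: "x \<in> topspace X" and "1 - 1 / M < u (?e x)" by (auto simp: trace_def N_def)
      then have tM: "M < t x" using \<open>M > 0\<close> u(3)[OF x] by (simp add: t_def field_simps)
      define q where "q = nat \<lfloor>t x / 4\<rfloor>"
      have "t x > 0" using tM \<open>M > 0\<close> by simp
      then have q: "4 * real q \<le> t x" "t x < 4 * real q + 4" unfolding q_def by linarith+
      then have "real (m1 + m2 + 1) < real (q + 1)" using tM unfolding M_def by simp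
      then have "m1 \<le> q" "m2 \<le> q" by linarith+
      consider "\<bar>t x - 4 * real q\<bar> < 3/2" | "\<bar>t x - 2 - 4 * real q\<bar> < 3/2"
        | "\<bar>t x - 4 * real (Suc q)\<bar> < 3/2"
        using q by (simp only: of_nat_Suc) argo
      then show "x \<in> \<Union>{?A t m1, ?A (\<lambda>x. t x - 2) m2}"
      proof cases
        case 1
        then have "x \<in> ?A t m1" using \<open>m1 \<le> q\<close> x by (auto simp: level_band_def)
        then show ?thesis by blast
      next
        case 2
        then have "x \<in> ?A (\<lambda>x. t x - 2) m2" using \<open>m2 \<le> q\<close> x by (auto simp: level_band_def)
        then show ?thesis by blast
      next
        case 3
        then have "x \<in> level_band X t (Suc q)" using x by (simp add: level_band_def)
        then have "x \<in> ?A t m1" using \<open>m1 \<le> q\<close> by (meson UN_iff atLeast_iff le_SucI)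
        then show ?thesis by blast
      qed
    qed
    ultimately show False using p(2) null_mono[OF null12] by blast
  qed
  then obtain x where x: "x \<in> topspace X" "p = ?e x" by blast
  have emb: "embedding_map X ?B ?e" by (rule embedding_map_stone_cech[OF X_Hausdorff X_cr])
  have "\<not> misses U V" if "openin X U" "x \<in> U" "openin Y V" "y \<in> V" for U V
  proof
    assume "misses U V"
    have "openin (subtopology ?B (?e ` topspace X)) (?e ` U)"
      using emb that(1) unfolding embedding_map_def
      by (simp add: homeomorphic_map_openness_eq openin_subset)
    then obtain N where N: "openin ?B N" "?e ` U = N \<inter> ?e ` topspace X"
      by (auto simp: openin_subtopology)
    have "inj_on ?e (topspace X)"
      using emb unfolding embedding_map_def homeomorphic_eq_everything_map by blast
    then have "trace N \<subseteq> U"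
      using N(2) openin_subset[OF that(1)] unfolding trace_def inj_on_def by blast
    moreover have "p \<in> N" using N(2) that(2) x by blast
    ultimately show False
      using p(2)[OF N(1)] null_mono \<open>misses U V\<close> that unfolding null_def by blast
  qed
  then show ?thesis using x y by (auto simp: corresponds_def)
qed

lemma corresponds_choice_continuous:
  assumes g: "\<And>y. y \<in> topspace Y \<Longrightarrow> corresponds (g y) y"
  shows "continuous_map Y X g"
  unfolding continuous_map
proof (intro conjI allI impI)
  show "g ` topspace Y \<subseteq> topspace X" using g by (auto simp: corresponds_def)
  fix Q assume Q: "openin X Q"
  show "openin Y {y \<in> topspace Y. g y \<in> Q}"
  proof (subst openin_subopen, clarify)
    fix y assume y: "y \<in> topspace Y" "g y \<in> Q"
    obtain V where V: "openin Y V" "y \<in> V" "\<And>x' y'. y' \<in> V \<Longrightarrow> corresponds x' y' \<Longrightarrow> x' \<in> Q"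
      using corresponds_local[OF g[OF y(1)] Q y(2)] by metis
    have "V \<subseteq> {y \<in> topspace Y. g y \<in> Q}"
      using V(3) g openin_subset[OF V(1)] by blast
    then show "\<exists>V. openin Y V \<and> y \<in> V \<and> V \<subseteq> {y \<in> topspace Y. g y \<in> Q}"
      using V by blast
  qed
qed

end

theorem theorem3p8:
  fixes X :: "'a topology" and Y :: "'b topology"
    and T :: "('a \<Rightarrow> 'e::{topological_real_vector,t2_space}) \<Rightarrow>
              ('b \<Rightarrow> 'f::{topological_real_vector,t2_space})"
  assumes "realcompact_space X" and "realcompact_space Y"
    and "\<exists>v::'e. v \<noteq> 0" and "\<exists>w::'f. w \<noteq> 0"
    and "biseparating X Y T"
  shows "X homeomorphic_space Y"
proof -
  interpret T: biseparating_map X Y T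
    using assms by unfold_locales (auto simp: realcompact_space_def)
  interpret S: biseparating_map Y X T.S by (rule T.inverse)
  obtain a where a: "\<And>y. y \<in> topspace Y \<Longrightarrow> T.corresponds (a y) y"
    using T.corresponds_total[OF assms(1)] by metis
  obtain b where b: "\<And>x. x \<in> topspace X \<Longrightarrow> S.corresponds (b x) x"
    using S.corresponds_total[OF assms(2)] by metis
  have ca: "continuous_map Y X a" and cb: "continuous_map X Y b"
    using a b by (blast intro: T.corresponds_choice_continuous S.corresponds_choice_continuous)+
  have "a (b x) = x" if "x \<in> topspace X" for x
  proof -
    have "T.corresponds x (b x)" using b[OF that] T.corresponds_inverse_iff by blast
    moreover have "b x \<in> topspace Y" using b[OF that] by (simp add: S.corresponds_def)
    ultimately show ?thesis using T.corresponds_unique a by blast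
  qed
  moreover have "b (a y) = y" if "y \<in> topspace Y" for y
  proof -
    have "S.corresponds y (a y)" using a[OF that] T.corresponds_inverse_iff by blast
    moreover have "a y \<in> topspace X" using a[OF that] by (simp add: T.corresponds_def)
    ultimately show ?thesis using S.corresponds_unique b by blast
  qed
  ultimately show ?thesis
    unfolding homeomorphic_space_def homeomorphic_maps_def using ca cb by blast
qed

end
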